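(* Let $m,l\in\mathbb{N}$, let $X_1,\dots,X_m$ be ordered vector spaces, $Z_1,\dots,Z_m$ real linear spaces, $Y_1,\dots,Y_l$ normed lattices. For $i=1,\dots,l$, $j=1,\dots,m$ let $A_{ij}:X_j\to Y_i$ be positive linear operators with domains of definition $\mathcal{D}(A_{ij})$, let $I_j:X_j\to Z_j$ be odd maps (information operators), $W_j\subset\bigcap_{i=1}^l\mathcal{D}(A_{ij})$ centrally symmetric classes, $U_j\subset Z_j$ centrally symmetric sets, and let $\psi:\mathbb{R}^l\to\mathbb{R}$ be a norm monotone with respect to the natural partial ordering. Suppose that for every $j=1,\dots,m$ there exist an operator $L_j:Z_j\to X_j$ with $L_j(Z_j)\subset\bigcap_{i=1}^l\mathcal{D}(A_{ij})$ and an element $\varphi_j\in W_j$ with $I_j\varphi_j\in U_j$, such that for any $\overline x\in\overline W$ and $\overline z\in\overline Z$, $$\overline z\in\overline I\,\overline x+\overline U\ \Longrightarrow\ \forall j=1,\dots,m:\ -\varphi_j\prec_{X_j}x_j-L_jz_j\prec_{X_j}\varphi_j .$$ Then for every $\sigma=\mathrm{diag}(\sigma_1,\dots,\sigma_m)$, $\sigma_j\in\{-1,1\}$, the operator $\Phi=\overline A\sigma\overline L$ is an optimal method of recovery of the operator $\overline A\sigma$ on the class $\overline W$ based on information $\overline I$ with $\overline U$-error, and $$\mathcal{E}_\psi(\overline A\sigma;\overline W;\overline I;\overline U)=\mathcal{E}_\psi(\overline A\sigma;\overline W;\overline I;\overline U;\Phi)=\|\overline A\,\overline\varphi\|_\p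si,\qquad\overline\varphi=(\varphi_1,\dots,\varphi_m)^T.$$
   Context: An ordered vector space $(X,\prec_X)$ is a real linear space with a partial order such that $x\prec_Xy$ implies $x+z\prec_Xy+z$ and $\lambda x\prec_X\lambda y$ for all $z\in X$, $\lambda\ge0$. A normed lattice is a real normed space that is an ordered vector space and a vector lattice (suprema and infima of pairs exist) with $|x|\prec|y|\Rightarrow\|x\|\le\|y\|$, where $|x|=x\vee(-x)$. A linear operator $T$ between ordered vector spaces, defined on a linear subspace, is positive if $\theta\prec Tx$ whenever $\theta\prec x$ (with $x$ in the domain); $\theta$ denotes zero. A set $S$ is centrally symmetric if $S=-S$. The norm $\psi$ is monotone if $\psi(a)\le\psi(b)$ whenever $0\le a_i\le b_i$ for all $i$. The operators $L_j$ need not be linear. Notation: $\overline W=W_1\times\dots\times W_m$, $\overline U=U_1\times\dots\times U_m$, $\overline Z=Z_1\times\dots\times Z_m$, $\overline Y=Y_1\times\dots\times Y_l$ with $\|\overline y\|_\psi=\psi(\|y_1\|_{Y_1},\dots,\|y_l\|_{Y_l})$. $\overline I=\mathrm{diag}(I_1,\dots,I_m)$, i.e. $\overline I\,\overline x=(I_1x_1,\dots,I_mx_m)$; $\overline L=\mathrm{diag}(L_1,\dots,L_m)$; $\overline A=(A_{ij})$, $(\overline A\,\overline x)_i=\sum_jA_{ij}x_j$; $(\overline A\sigma\overline x)_i=\sum_j\sigma_jA_{ij}x_j$; $(\overline A\sigma\overline L\,\overline z)_i=\sum_j\sigma_jA_{ij}L_jz_j$. A method of recovery is an arbitrary map $\Phi:\overline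 Z\to\overline Y$. For an operator $T:\overline W\to\overline Y$, $\mathcal{E}_\psi(T;\overline W;\overline I;\overline U;\Phi)=\sup_{\overline x\in\overline W}\sup_{\overline z\in\overline I\,\overline x+\overline U}\|T\overline x-\Phi\overline z\|_\psi$ and $\mathcal{E}_\psi(T;\overline W;\overline I;\overline U)=\inf_\Phi\mathcal{E}_\psi(T;\overline W;\overline I;\overline U;\Phi)$. A method is optimal if it attains this infimum. *)

theory Defs
  imports "HOL-Analysis.Analysis"
begin

text \<open>
  A finite family of different spaces \<open>(V\<^sub>k)\<close>, each with its own order and norm, is rendered as a
  family of linear subspaces \<open>V k\<close> of one ambient real vector space, each carrying its own order
  relation \<open>r k \<subseteq> V k \<times> V k\<close> and its own norm \<open>N k\<close>. No generality is lost: an arbitrary family is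
  recovered by taking the direct sum as ambient space. Nothing relates the orders and norms for
  different indices, and the subspaces may overlap arbitrarily.
  The ranges \<open>{1..m}\<close>, \<open>{1..l}\<close> are finite index types, and elements of the Cartesian products are
  vectors \<open>'a ^ 'n\<close> whose \<open>k\<close>-th component lies in the \<open>k\<close>-th set.
\<close>

definition ordered_vector_space_on ::
    "'a::real_vector set \<Rightarrow> ('a \<times> 'a) set \<Rightarrow> bool" where
  "ordered_vector_space_on V r \<longleftrightarrow>
     subspace V \<and> partial_order_on V r \<and>
     (\<forall>x y. (x, y) \<in> r \<longrightarrow>
        (\<forall>z\<in>V. (x + z, y + z) \<in> r) \<and> (\<forall>c\<ge>0. (c *\<^sub>R x, c *\<^sub>R y) \<in> r))"

definition is_join :: "'a set \<Rightarrow> ('a \<times> 'a) set \<Rightarrow> 'a \<Rightarrow> 'a \<Rightarrow> 'a \<Rightarrow> bool" where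
  "is_join V r x y s \<longleftrightarrow>
     s \<in> V \<and> (x, s) \<in> r \<and> (y, s) \<in> r \<and> (\<forall>u\<in>V. (x, u) \<in> r \<and> (y, u) \<in> r \<longrightarrow> (s, u) \<in> r)"

definition is_meet :: "'a set \<Rightarrow> ('a \<times> 'a) set \<Rightarrow> 'a \<Rightarrow> 'a \<Rightarrow> 'a \<Rightarrow> bool" where
  "is_meet V r x y s \<longleftrightarrow>
     s \<in> V \<and> (s, x) \<in> r \<and> (s, y) \<in> r \<and> (\<forall>u\<in>V. (u, x) \<in> r \<and> (u, y) \<in> r \<longrightarrow> (u, s) \<in> r)"

definition vector_lattice_on ::
    "'a::real_vector set \<Rightarrow> ('a \<times> 'a) set \<Rightarrow> bool" where
  "vector_lattice_on V r \<longleftrightarrow>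
     ordered_vector_space_on V r \<and>
     (\<forall>x\<in>V. \<forall>y\<in>V. (\<exists>s. is_join V r x y s) \<and> (\<exists>s. is_meet V r x y s))"

definition modulus_on :: "'a::real_vector set \<Rightarrow> ('a \<times> 'a) set \<Rightarrow> 'a \<Rightarrow> 'a" where
  "modulus_on V r x = (THE s. is_join V r x (- x) s)"

definition norm_on :: "'a::real_vector set \<Rightarrow> ('a \<Rightarrow> real) \<Rightarrow> bool" where
  "norm_on V N \<longleftrightarrow>
     (\<forall>x\<in>V. 0 \<le> N x) \<and>
     (\<forall>x\<in>V. N x = 0 \<longleftrightarrow> x = 0) \<and>
     (\<forall>c. \<forall>x\<in>V. N (c *\<^sub>R x) = \<bar>c\<bar> * N x) \<and>
     (\<forall>x\<in>V. \<forall>y\<in>V. N (x + y) \<le> N x + N y)"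

definition normed_lattice_on ::
    "'a::real_vector set \<Rightarrow> ('a \<times> 'a) set \<Rightarrow> ('a \<Rightarrow> real) \<Rightarrow> bool" where
  "normed_lattice_on V r N \<longleftrightarrow>
     vector_lattice_on V r \<and> norm_on V N \<and>
     (\<forall>x\<in>V. \<forall>y\<in>V. (modulus_on V r x, modulus_on V r y) \<in> r \<longrightarrow> N x \<le> N y)"

definition linear_operator_on ::
    "'a::real_vector set \<Rightarrow> 'a set \<Rightarrow> 'b::real_vector set \<Rightarrow> ('a \<Rightarrow> 'b) \<Rightarrow> bool" where
  "linear_operator_on D V E T \<longleftrightarrow>
     subspace D \<and> D \<subseteq> V \<and> T \<in> D \<rightarrow> E \<and>
     (\<forall>x\<in>D. \<forall>y\<in>D. T (x + y) = T x + T y) \<and>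
     (\<forall>c. \<forall>x\<in>D. T (c *\<^sub>R x) = c *\<^sub>R T x)"

definition positive_operator_on ::
    "'a::real_vector set \<Rightarrow> ('a \<times> 'a) set \<Rightarrow> ('b::real_vector \<times> 'b) set \<Rightarrow> ('a \<Rightarrow> 'b) \<Rightarrow> bool" where
  "positive_operator_on D r s T \<longleftrightarrow> (\<forall>x\<in>D. (0, x) \<in> r \<longrightarrow> (0, T x) \<in> s)"

definition odd_on :: "'a::real_vector set \<Rightarrow> ('a \<Rightarrow> 'b::real_vector) \<Rightarrow> bool" where
  "odd_on V f \<longleftrightarrow> (\<forall>x\<in>V. f (- x) = - f x)"

definition centrally_symmetric :: "'a::real_vector set \<Rightarrow> bool" where
  "centrally_symmetric S \<longleftrightarrow> S = uminus ` S"

definition monotone_norm :: "(real ^ 'l \<Rightarrow> real) \<Rightarrow> bool" where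
  "monotone_norm \<psi> \<longleftrightarrow>
     norm_on UNIV \<psi> \<and> (\<forall>a b. (\<forall>i. 0 \<le> a $ i \<and> a $ i \<le> b $ i) \<longrightarrow> \<psi> a \<le> \<psi> b)"

definition prod_set :: "('n \<Rightarrow> 'a set) \<Rightarrow> ('a ^ 'n) set" where
  "prod_set S = {x. \<forall>k. x $ k \<in> S k}"

definition prod_norm ::
    "(real ^ 'l \<Rightarrow> real) \<Rightarrow> ('l \<Rightarrow> 'y \<Rightarrow> real) \<Rightarrow> 'y ^ 'l \<Rightarrow> real" where
  "prod_norm \<psi> N y = \<psi> (\<chi> i. N i (y $ i))"

definition diag_op :: "('m \<Rightarrow> 'a \<Rightarrow> 'b) \<Rightarrow> 'a ^ 'm \<Rightarrow> 'b ^ 'm" where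
  "diag_op F x = (\<chi> j. F j (x $ j))"

definition matrix_op ::
    "('l \<Rightarrow> 'm \<Rightarrow> 'a \<Rightarrow> 'b::real_vector) \<Rightarrow> 'a ^ 'm \<Rightarrow> 'b ^ 'l" where
  "matrix_op A x = (\<chi> i. \<Sum>j\<in>UNIV. A i j (x $ j))"

text \<open>\<open>signed_matrix_op A \<sigma>\<close> is the operator \<open>A \<sigma>\<close> with \<open>\<sigma> = diag (\<sigma>\<^sub>1, \<dots>, \<sigma>\<^sub>m)\<close>.\<close>

definition signed_matrix_op ::
    "('l \<Rightarrow> 'm \<Rightarrow> 'a \<Rightarrow> 'b::real_vector) \<Rightarrow> real ^ 'm \<Rightarrow> 'a ^ 'm \<Rightarrow> 'b ^ 'l" where
  "signed_matrix_op A \<sigma> x = (\<chi> i. \<Sum>j\<in>UNIV. \<sigma> $ j *\<^sub>R A i j (x $ j))"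

text \<open>
  In the following, \<open>W\<close>, \<open>U\<close>, \<open>Z\<close>, \<open>Y\<close> are the product sets, \<open>I\<close> is the information operator on the
  product, and \<open>N\<close> is the norm on the target space. Errors are extended real numbers, as the error
  of a method may be infinite.
\<close>

definition method_error ::
    "('y::real_vector \<Rightarrow> real) \<Rightarrow> ('x \<Rightarrow> 'y) \<Rightarrow> 'x set \<Rightarrow> ('x \<Rightarrow> 'z::real_vector) \<Rightarrow> 'z set
      \<Rightarrow> ('z \<Rightarrow> 'y) \<Rightarrow> ereal" where
  "method_error N T W I U \<Phi> = (SUP x\<in>W. SUP z\<in>(+) (I x) ` U. ereal (N (T x - \<Phi> z)))"

definition optimal_error ::
    "'z::real_vector set \<Rightarrow> 'y::real_vector set \<Rightarrow> ('y \<Rightarrow> real) \<Rightarrow> ('x \<Rightarrow> 'y) \<Rightarrow> 'x set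
      \<Rightarrow> ('x \<Rightarrow> 'z) \<Rightarrow> 'z set \<Rightarrow> ereal" where
  "optimal_error Z Y N T W I U = (INF \<Phi>\<in>Z \<rightarrow> Y. method_error N T W I U \<Phi>)"

definition optimal_method ::
    "'z::real_vector set \<Rightarrow> 'y::real_vector set \<Rightarrow> ('y \<Rightarrow> real) \<Rightarrow> ('x \<Rightarrow> 'y) \<Rightarrow> 'x set
      \<Rightarrow> ('x \<Rightarrow> 'z) \<Rightarrow> 'z set \<Rightarrow> ('z \<Rightarrow> 'y) \<Rightarrow> bool" where
  "optimal_method Z Y N T W I U \<Phi> \<longleftrightarrow>
     \<Phi> \<in> Z \<rightarrow> Y \<and> method_error N T W I U \<Phi> = optimal_error Z Y N T W I U"

end

theory Submission
  imports Defs
begin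

text \<open>
  Upper bound: positivity of the operators \<open>A\<^sub>i\<^sub>j\<close> turns \<open>- \<phi>\<^sub>j \<prec> x\<^sub>j - L\<^sub>j z\<^sub>j \<prec> \<phi>\<^sub>j\<close> into
  \<open>- (A \<phi>)\<^sub>i \<prec> (A \<sigma> x - A \<sigma> L z)\<^sub>i \<prec> (A \<phi>)\<^sub>i\<close>, because this two-sided bound is insensitive to the
  signs \<open>\<sigma>\<^sub>j\<close>; the lattice norms and \<open>\<psi>\<close> are monotone.
  Lower bound: the elements \<open>\<sigma> \<phi>\<close> and \<open>- \<sigma> \<phi>\<close> of the class are both compatible with the
  information \<open>0\<close>, while \<open>A \<sigma>\<close> maps them to \<open>A \<phi>\<close> and \<open>- A \<phi>\<close>. Any method gives a single
  answer to \<open>0\<close>, so by the triangle inequality it errs by at least the norm of \<open>A \<phi>\<close> on one of them.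
\<close>

section \<open>Order inequalities on a subspace and positive operators\<close>

lemma ordered_vector_space_onD:
  assumes "ordered_vector_space_on V r"
  shows "subspace V" "r \<subseteq> V \<times> V" "\<And>x. x \<in> V \<Longrightarrow> (x, x) \<in> r" "trans r" "antisym r"
    "\<And>x y z. (x, y) \<in> r \<Longrightarrow> z \<in> V \<Longrightarrow> (x + z, y + z) \<in> r"
    "\<And>x y c. (x, y) \<in> r \<Longrightarrow> 0 \<le> c \<Longrightarrow> (c *\<^sub>R x, c *\<^sub>R y) \<in> r"
  using assms unfolding ordered_vector_space_on_def partial_order_on_def preorder_on_def refl_on_def
  by auto

lemma ordered_vector_space_on_add_mono:
  assumes V: "ordered_vector_space_on V r" and "(a, b) \<in> r" "(c, d) \<in> r"
  shows "(a + c, b + d) \<in> r"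
proof -
  note V = ordered_vector_space_onD[OF V]
  have "b \<in> V" "c \<in> V" using V(2) assms by auto
  then have "(a + c, b + c) \<in> r" "(c + b, d + b) \<in> r" using V(6) assms by auto
  then show ?thesis using V(4) by (metis add.commute transD)
qed

lemma ordered_vector_space_on_neg_mono:
  assumes V: "ordered_vector_space_on V r" and "(a, b) \<in> r"
  shows "(- b, - a) \<in> r"
proof -
  note V = ordered_vector_space_onD[OF V]
  have "a \<in> V" "b \<in> V" using V(2) assms by auto
  \<comment> \<open>Translation by \<open>- a - b\<close> turns \<open>a\<close> into
    \<open>- b\<close> and \<open>b\<close> into \<open>- a\<close>.\<close>
  then have "- a - b \<in> V" using V(1) by (simp add: subspace_diff subspace_neg)
  then have "(a + (- a - b), b + (- a - b)) \<in> r" using V(6) assms by blast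
  then show ?thesis by simp
qed

lemma ordered_vector_space_on_sum_mono:
  assumes V: "ordered_vector_space_on V r" and "\<And>j. j \<in> J \<Longrightarrow> (f j, g j) \<in> r"
  shows "(\<Sum>j\<in>J. f j, \<Sum>j\<in>J. g j) \<in> r"
  using assms(2)
proof (induction J rule: infinite_finite_induct)
  case (insert j J)
  then show ?case by (simp add: ordered_vector_space_on_add_mono[OF V])
\<comment> \<open>For empty or infinite \<open>J\<close> both sums are 0, and reflexivity at 0
  suffices.\<close>
qed (use ordered_vector_space_onD(1,3)[OF V] subspace_0 in auto)

text \<open>Positivity applies to \<open>b - a\<close>, which stays in the domain because
  \<open>D\<close> is a subspace; adding \<open>T a\<close> and using additivity gives the
  comparison of values.\<close>

lemma positive_linear_operator_mono:
  assumes X: "ordered_vector_space_on X r" and Y: "ordered_vector_space_on Y s"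
    and T: "linear_operator_on D X Y T" "positive_operator_on D r s T"
    and "a \<in> D" "b \<in> D" "(a, b) \<in> r"
  shows "(T a, T b) \<in> s"
proof -
  have D: "subspace D" "D \<subseteq> X" "T \<in> D \<rightarrow> Y" using T by (auto simp: linear_operator_on_def)
  have "- a \<in> X" "b - a \<in> D"
    using D assms(5,6) ordered_vector_space_onD(1)[OF X] by (auto intro: subspace_neg subspace_diff)
  then have "(0, T (b - a)) \<in> s"
    using ordered_vector_space_onD(6)[OF X assms(7) \<open>- a \<in> X\<close>] T(2)
    by (simp add: positive_operator_on_def)
  then have "(0 + T a, T (b - a) + T a) \<in> s"
    using ordered_vector_space_onD(6)[OF Y] D assms(5) by blast
  moreover have "T (b - a + a) = T (b - a) + T a"
    using T(1) \<open>b - a \<in> D\<close> assms(5) unfolding linear_operator_on_def by blast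
  ultimately show ?thesis by simp
qed

lemma linear_operator_on_neg:
  assumes "linear_operator_on D X Y T" "x \<in> D"
  shows "T (- x) = - T x"
  using assms unfolding linear_operator_on_def by (metis scaleR_minus1_left)

lemma linear_operator_on_diff:
  assumes "linear_operator_on D X Y T" "x \<in> D" "y \<in> D"
  shows "T (x - y) = T x - T y"
proof -
  have "- y \<in> D" using assms by (simp add: linear_operator_on_def subspace_neg)
  then have "T (x + - y) = T x + T (- y)" using assms unfolding linear_operator_on_def by blast
  then show ?thesis using linear_operator_on_neg assms by fastforce
qed

section \<open>Moduli and lattice norms\<close>

lemma modulus_on_eqI:
  assumes "ordered_vector_space_on V r" "is_join V r x (- x) s"
  shows "modulus_on V r x = s"
  unfolding modulus_on_def
proof (rule the_equality)
  show "\<And>t. is_join V r x (- x) t \<Longrightarrow> t = s"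
    using assms(2) ordered_vector_space_onD(5)[OF assms(1)] by (auto simp: is_join_def antisym_def)
qed (fact assms(2))

text \<open>Transitivity gives \<open>- g\<close> below \<open>g\<close>, so \<open>g\<close> is its
  own modulus. Since \<open>g\<close> lies above both \<open>e\<close> and \<open>- e\<close>, it
  lies above their join, the modulus of \<open>e\<close>, and the lattice property of the norm
  applies.\<close>

lemma normed_lattice_on_norm_le:
  assumes Y: "normed_lattice_on V r N" and e: "(- g, e) \<in> r" "(e, g) \<in> r"
  shows "N e \<le> N g"
proof -
  have V: "ordered_vector_space_on V r" and lattice: "vector_lattice_on V r"
    using Y by (auto simp: normed_lattice_on_def vector_lattice_on_def)
  note V' = ordered_vector_space_onD[OF V]
  have mem: "e \<in> V" "g \<in> V" "- e \<in> V" using V'(1,2) e by (auto intro: subspace_neg)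
  have "(- g, g) \<in> r" using e V'(4) by (auto dest: transD)
  then have "is_join V r g (- g) g" using mem V'(3) by (simp add: is_join_def)
  then have g: "modulus_on V r g = g" by (rule modulus_on_eqI[OF V])
  obtain s where s: "is_join V r e (- e) s"
    using lattice mem unfolding vector_lattice_on_def by blast
  have "(- e, g) \<in> r" using ordered_vector_space_on_neg_mono[OF V e(1)] by simp
  then have "(s, g) \<in> r" using s e(2) mem by (simp add: is_join_def)
  then have "(modulus_on V r e, modulus_on V r g) \<in> r"
    using g modulus_on_eqI[OF V s] by simp
  then show ?thesis using Y mem unfolding normed_lattice_on_def by blast
qed

section \<open>The norm on the product space\<close>

lemma prod_norm_mono:
  assumes "monotone_norm \<psi>" "\<And>i. 0 \<le> N i (x $ i)" "\<And>i. N i (x $ i) \<le> N i (y $ i)"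
  shows "prod_norm \<psi> N x \<le> prod_norm \<psi> N y"
  using assms by (simp add: prod_norm_def monotone_norm_def)

text \<open>The triangle inequality takes two steps: monotonicity of \<psi> carries over the
  componentwise inequalities of the \<open>N i\<close>, then \<psi> itself is subadditive.\<close>

lemma norm_on_prod_norm:
  fixes V :: "'l::finite \<Rightarrow> 'a::real_vector set"
  assumes \<psi>: "monotone_norm \<psi>" and V: "\<And>i. subspace (V i)" and N: "\<And>i. norm_on (V i) (N i)"
  shows "norm_on (prod_set V) (prod_norm \<psi> N)"
proof -
  have \<psi>_norm: "norm_on UNIV \<psi>" using \<psi> by (simp add: monotone_norm_def)
  have "prod_norm \<psi> N (x + y) \<le> prod_norm \<psi> N x + prod_norm \<psi> N y"
    if "x \<in> prod_set V" "y \<in> prod_set V" for x y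
  proof -
    have mem: "x $ i \<in> V i" "y $ i \<in> V i" "x $ i + y $ i \<in> V i" for i
      using that V by (auto simp: prod_set_def intro: subspace_add)
    have "prod_norm \<psi> N (x + y) \<le> \<psi> ((\<chi> i. N i (x $ i)) + (\<chi> i. N i (y $ i)))"
      using \<psi> N mem by (simp add: prod_norm_def monotone_norm_def norm_on_def)
    also have "\<dots> \<le> prod_norm \<psi> N x + prod_norm \<psi> N y"
      using \<psi>_norm by (simp add: prod_norm_def norm_on_def)
    finally show ?thesis .
  qed
  moreover have "prod_norm \<psi> N (c *\<^sub>R x) = \<bar>c\<bar> * prod_norm \<psi> N x" if "x \<in> prod_set V" for c x
  proof -
    have "(\<chi> i. N i ((c *\<^sub>R x) $ i)) = \<bar>c\<bar> *\<^sub>R (\<chi> i. N i (x $ i))"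
      using that N by (simp add: vec_eq_iff prod_set_def norm_on_def)
    then show ?thesis using \<psi>_norm by (simp add: prod_norm_def norm_on_def)
  qed
  moreover have "prod_norm \<psi> N x = 0 \<longleftrightarrow> x = 0" if "x \<in> prod_set V" for x
    using that \<psi>_norm N by (simp add: prod_norm_def norm_on_def prod_set_def vec_eq_iff)
  ultimately show ?thesis using \<psi>_norm by (simp add: norm_on_def prod_norm_def)
qed

lemma subspace_prod_set:
  assumes "\<And>k. subspace (V k)"
  shows "subspace (prod_set V)"
  using assms by (simp add: subspace_def prod_set_def)

lemma centrally_symmetric_uminus:
  assumes "centrally_symmetric S" "x \<in> S"
  shows "- x \<in> S"
  using assms unfolding centrally_symmetric_def by blast

section \<open>Bounds for errors of recovery methods\<close>

lemma method_error_ge: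
  assumes "x \<in> W" "u \<in> U"
  shows "ereal (N (T x - \<Phi> (I x + u))) \<le> method_error N T W I U \<Phi>"
  unfolding method_error_def
  by (rule SUP_upper2[OF assms(1)], rule SUP_upper) (use assms in blast)

lemma method_error_le:
  assumes "\<And>x u. x \<in> W \<Longrightarrow> u \<in> U \<Longrightarrow> N (T x - \<Phi> (I x + u)) \<le> c"
  shows "method_error N T W I U \<Phi> \<le> ereal c"
  unfolding method_error_def by (intro SUP_least) (use assms in auto)

text \<open>The conditions \<open>- I x \<in> U\<close> and \<open>- I x' \<in> U\<close> make 0
  admissible data for both elements. The two errors at 0 are compared through 2 T x = (T x - \<Phi>
  0) + (T x + \<Phi> 0).\<close>

lemma method_error_lower_bound:
  assumes N: "norm_on Y N" and Y: "subspace Y"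
    and x: "x \<in> W" "- I x \<in> U" and x': "x' \<in> W" "- I x' \<in> U"
    and T: "T x \<in> Y" "T x' = - T x" and \<Phi>: "\<Phi> 0 \<in> Y"
  shows "ereal (N (T x)) \<le> method_error N T W I U \<Phi>"
proof -
  let ?a = "T x" and ?y = "\<Phi> 0"
  have "?a - ?y \<in> Y" "- ?a - ?y \<in> Y" "?a + ?y \<in> Y"
    using T \<Phi> Y by (auto intro: subspace_diff subspace_neg subspace_add)
  moreover have "N (- 1 *\<^sub>R (- ?a - ?y)) = \<bar>- 1\<bar> * N (- ?a - ?y)"
    using N \<open>- ?a - ?y \<in> Y\<close> unfolding norm_on_def by blast
  then have "N (?a + ?y) = N (- ?a - ?y)" by (simp add: add.commute)
  moreover have "N ((?a - ?y) + (?a + ?y)) \<le> N (?a - ?y) + N (?a + ?y)"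
    using N calculation unfolding norm_on_def by blast
  moreover have "(?a - ?y) + (?a + ?y) = 2 *\<^sub>R ?a" by (simp add: scaleR_2)
  moreover have "N (2 *\<^sub>R ?a) = \<bar>2\<bar> * N ?a" using N T unfolding norm_on_def by blast
  \<comment> \<open>The mean of the two errors is at least \<open>N ?a\<close>, hence so is one of
    them.\<close>
  ultimately have "N ?a \<le> N (?a - ?y) \<or> N ?a \<le> N (- ?a - ?y)" by auto
  moreover have "ereal (N (?a - ?y)) \<le> method_error N T W I U \<Phi>"
    using method_error_ge[of x W "- I x" U N T \<Phi> I] x by simp
  moreover have "ereal (N (- ?a - ?y)) \<le> method_error N T W I U \<Phi>"
    using method_error_ge[of x' W "- I x'" U N T \<Phi> I] x' T by simp
  ultimately show ?thesis by (meson ereal_less_eq(3) order_trans)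
qed

text \<open>A common lower bound for the errors of all methods that one method does not exceed is
  the infimum, attained there.\<close>

lemma optimal_methodI:
  assumes "\<Phi> \<in> Z \<rightarrow> Y" "method_error N T W I U \<Phi> \<le> c"
    and "\<And>\<Psi>. \<Psi> \<in> Z \<rightarrow> Y \<Longrightarrow> c \<le> method_error N T W I U \<Psi>"
  shows "optimal_method Z Y N T W I U \<Phi> \<and>
    optimal_error Z Y N T W I U = method_error N T W I U \<Phi> \<and> method_error N T W I U \<Phi> = c"
proof -
  have "method_error N T W I U \<Phi> = c" using assms by (meson order_antisym)
  moreover have "optimal_error Z Y N T W I U = c"
    unfolding optimal_error_def
    using assms calculation by (intro order_antisym INF_lower2[OF assms(1)] INF_greatest) auto
  ultimately show ?thesis using assms(1) by (simp add: optimal_method_def)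
qed

theorem theorem2p1:
  fixes X :: "'m::finite \<Rightarrow> 'x::real_vector set"
    and leX :: "'m \<Rightarrow> ('x \<times> 'x) set"
    and Z :: "'m \<Rightarrow> 'z::real_vector set"
    and Y :: "'l::finite \<Rightarrow> 'y::real_vector set"
    and leY :: "'l \<Rightarrow> ('y \<times> 'y) set"
    and normY :: "'l \<Rightarrow> 'y \<Rightarrow> real"
    and D :: "'l \<Rightarrow> 'm \<Rightarrow> 'x set"
    and A :: "'l \<Rightarrow> 'm \<Rightarrow> 'x \<Rightarrow> 'y"
    and I :: "'m \<Rightarrow> 'x \<Rightarrow> 'z"
    and W :: "'m \<Rightarrow> 'x set"
    and U :: "'m \<Rightarrow> 'z set"
    and \<psi> :: "real ^ 'l \<Rightarrow> real"
    and L :: "'m \<Rightarrow> 'z \<Rightarrow> 'x"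
    and \<phi> :: "'x ^ 'm"
    and \<sigma> :: "real ^ 'm"
  assumes "\<And>j. ordered_vector_space_on (X j) (leX j)"
    and "\<And>j. subspace (Z j)"
    and "\<And>i. normed_lattice_on (Y i) (leY i) (normY i)"
    and "\<And>i j. linear_operator_on (D i j) (X j) (Y i) (A i j)"
    and "\<And>i j. positive_operator_on (D i j) (leX j) (leY i) (A i j)"
    and "\<And>j. I j \<in> X j \<rightarrow> Z j"
    and "\<And>j. odd_on (X j) (I j)"
    and "\<And>j. W j \<subseteq> (\<Inter>i. D i j)"
    and "\<And>j. centrally_symmetric (W j)"
    and "\<And>j. U j \<subseteq> Z j"
    and "\<And>j. centrally_symmetric (U j)"
    and "monotone_norm \<psi>"
    and "\<And>j. L j \<in> Z j \<rightarrow> (\<Inter>i. D i j)"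
    and "\<And>j. \<phi> $ j \<in> W j"
    and "\<And>j. I j (\<phi> $ j) \<in> U j"
    and "\<And>x z. x \<in> prod_set W \<Longrightarrow> z \<in> prod_set Z \<Longrightarrow>
            z \<in> (+) (diag_op I x) ` prod_set U \<Longrightarrow>
            \<forall>j. (- (\<phi> $ j), x $ j - L j (z $ j)) \<in> leX j \<and>
                (x $ j - L j (z $ j), \<phi> $ j) \<in> leX j"
    and "\<And>j. \<sigma> $ j \<in> {- 1, 1}"
  defines "\<Phi> \<equiv> signed_matrix_op A \<sigma> \<circ> diag_op L"
  shows "optimal_method (prod_set Z) (prod_set Y) (prod_norm \<psi> normY) (signed_matrix_op A \<sigma>)
           (prod_set W) (diag_op I) (prod_set U) \<Phi> \<and>
         optimal_error (prod_set Z) (prod_set Y) (prod_norm \<psi> normY) (signed_matrix_op A \<sigma>)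
           (prod_set W) (diag_op I) (prod_set U) =
         method_error (prod_norm \<psi> normY) (signed_matrix_op A \<sigma>)
           (prod_set W) (diag_op I) (prod_set U) \<Phi> \<and>
         method_error (prod_norm \<psi> normY) (signed_matrix_op A \<sigma>)
           (prod_set W) (diag_op I) (prod_set U) \<Phi> =
         ereal (prod_norm \<psi> normY (matrix_op A \<phi>))"
proof -
  note X = assms(1) and Y = assms(3) and A = assms(4) and pos = assms(5) and \<psi> = assms(12)
    and bound = assms(16)
  have Y_ord: "ordered_vector_space_on (Y i) (leY i)" and Y_norm: "norm_on (Y i) (normY i)" for i
    using Y[of i] by (auto simp: normed_lattice_on_def vector_lattice_on_def)
  note Y_subspace = ordered_vector_space_onD(1)[OF Y_ord]
  have D: "subspace (D i j)" "D i j \<subseteq> X j" "A i j \<in> D i j \<rightarrow> Y i" for i j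
    using A[of i j] by (auto simp: linear_operator_on_def)
  have W_D: "x \<in> W j \<Longrightarrow> x \<in> D i j" for x i j using assms(8) by blast
  have L_D: "z \<in> Z j \<Longrightarrow> L j z \<in> D i j" for z i j using assms(13) by blast
  have \<sigma>: "\<sigma> $ j = - 1 \<or> \<sigma> $ j = 1" for j using assms(17) by blast

  have signed_Y: "signed_matrix_op A \<sigma> x \<in> prod_set Y" if "\<And>i j. x $ j \<in> D i j" for x
    using that D(3) Y_subspace
    by (auto simp: signed_matrix_op_def prod_set_def Pi_iff intro!: subspace_sum subspace_scale)
  have \<Phi>_Y: "\<Phi> \<in> prod_set Z \<rightarrow> prod_set Y"
    unfolding \<Phi>_def o_def by (intro Pi_I signed_Y) (simp add: diag_op_def prod_set_def L_D)

  have upper: "prod_norm \<psi> normY (signed_matrix_op A \<sigma> x - \<Phi> (diag_op I x + u))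
      \<le> prod_norm \<psi> normY (matrix_op A \<phi>)"
    if x: "x \<in> prod_set W" and u: "u \<in> prod_set U" for x u
  proof -
    define z where "z = diag_op I x + u"
    have xD: "x $ j \<in> D i j" for i j using x W_D by (simp add: prod_set_def)
    have "I j (x $ j) \<in> Z j" for j using xD D(2) assms(6) by blast
    moreover have "u $ j \<in> Z j" for j using u assms(10) by (auto simp: prod_set_def)
    \<comment> \<open>Membership in the product of the \<open>Z j\<close> makes the hypothesis on
      \<open>L\<close> available for \<open>z\<close>.\<close>
    ultimately have z: "z \<in> prod_set Z"
      using assms(2) by (simp add: z_def prod_set_def diag_op_def subspace_add)
    have zD: "L j (z $ j) \<in> D i j" for i j using z L_D by (simp add: prod_set_def)
    let ?d = "\<lambda>j. x $ j - L j (z $ j)"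
    have d: "(- (\<phi> $ j), ?d j) \<in> leX j" "(?d j, \<phi> $ j) \<in> leX j" for j
      using bound[OF x z] u by (auto simp: z_def)
    have \<phi>D: "\<phi> $ j \<in> D i j" "- (\<phi> $ j) \<in> D i j" and dD: "?d j \<in> D i j" for i j
      using assms(14) W_D D(1) xD zD by (auto intro: subspace_neg subspace_diff)
    let ?e = "signed_matrix_op A \<sigma> x - \<Phi> z"
    \<comment> \<open>Linearity of each \<open>A i j\<close> gathers the error into values at the
      differences \<open>?d j\<close>, which the hypothesis bounds.\<close>
    have e: "?e $ i = (\<Sum>j\<in>UNIV. \<sigma> $ j *\<^sub>R A i j (?d j))" for i
      by (simp add: \<Phi>_def signed_matrix_op_def diag_op_def sum_subtractf scaleR_diff_right
          linear_operator_on_diff[OF A xD zD])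
    have summand: "(- A i j (\<phi> $ j), \<sigma> $ j *\<^sub>R A i j (?d j)) \<in> leY i"
      "(\<sigma> $ j *\<^sub>R A i j (?d j), A i j (\<phi> $ j)) \<in> leY i" for i j
    proof -
      have lower: "(- A i j (\<phi> $ j), A i j (?d j)) \<in> leY i"
        using positive_linear_operator_mono[OF X Y_ord A pos \<phi>D(2) dD d(1)]
        by (simp add: linear_operator_on_neg[OF A \<phi>D(1)])
      have upper: "(A i j (?d j), A i j (\<phi> $ j)) \<in> leY i"
        by (rule positive_linear_operator_mono[OF X Y_ord A pos dD \<phi>D(1) d(2)])
      \<comment> \<open>If \<sigma> is -1 at \<open>j\<close>, negation interchanges the two bounds,
        so the symmetric interval is preserved.\<close>
      from \<sigma>[of j] lower upper
        ordered_vector_space_on_neg_mono[OF Y_ord lower] ordered_vector_space_on_neg_mono[OF Y_ord upper]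
      show "(- A i j (\<phi> $ j), \<sigma> $ j *\<^sub>R A i j (?d j)) \<in> leY i"
        "(\<sigma> $ j *\<^sub>R A i j (?d j), A i j (\<phi> $ j)) \<in> leY i" by auto
    qed
    have "(- (matrix_op A \<phi> $ i), ?e $ i) \<in> leY i" "(?e $ i, matrix_op A \<phi> $ i) \<in> leY i" for i
      unfolding e by (auto simp: matrix_op_def simp flip: sum_negf
          intro!: ordered_vector_space_on_sum_mono[OF Y_ord] summand)
    then have le: "normY i (?e $ i) \<le> normY i (matrix_op A \<phi> $ i)" "?e $ i \<in> Y i" for i
      using normed_lattice_on_norm_le[OF Y] ordered_vector_space_onD(2)[OF Y_ord] by blast+
    \<comment> \<open>Monotonicity of \<psi> is given only between vectors with nonnegative
      entries.\<close>
    then have "0 \<le> normY i (?e $ i)" for i using Y_norm unfolding norm_on_def by blast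
    then show ?thesis using le \<psi> unfolding z_def by (intro prod_norm_mono)
  qed

  have lower: "ereal (prod_norm \<psi> normY (matrix_op A \<phi>)) \<le> method_error (prod_norm \<psi> normY)
      (signed_matrix_op A \<sigma>) (prod_set W) (diag_op I) (prod_set U) \<Psi>"
    if \<Psi>: "\<Psi> \<in> prod_set Z \<rightarrow> prod_set Y" for \<Psi>
  proof -
    have \<phi>W: "\<phi> $ j \<in> W j" "- (\<phi> $ j) \<in> W j" for j
      using assms(9,14) centrally_symmetric_uminus by blast+
    have \<phi>D: "\<phi> $ j \<in> D i j" for i j using \<phi>W W_D by blast
    have I\<phi>: "I j (- (\<phi> $ j)) = - I j (\<phi> $ j)" for j
      using assms(7) \<phi>D D(2) unfolding odd_on_def by blast
    have IU: "I j (\<phi> $ j) \<in> U j" "- I j (\<phi> $ j) \<in> U j" for j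
      using assms(11,15) centrally_symmetric_uminus by blast+
    \<comment> \<open>The signs in \<open>x\<close> cancel those of the operator, since each
      \<sigma> entry squares to 1; the extremal value is thus A \<phi> for every choice of
      signs.\<close>
    define x where "x = (\<chi> j. \<sigma> $ j *\<^sub>R \<phi> $ j)"
    have x_cases: "x $ j = \<phi> $ j \<or> x $ j = - (\<phi> $ j)" for j using \<sigma>[of j] by (auto simp: x_def)
    have xW: "x \<in> prod_set W" "- x \<in> prod_set W"
      unfolding prod_set_def mem_Collect_eq using x_cases \<phi>W
      by (metis, metis minus_minus vector_uminus_component)
    \<comment> \<open>Each component is plus or minus \<open>I j (\<phi> $ j)\<close> by oddness of
      \<open>I j\<close>, and \<open>U j\<close> contains both by symmetry.\<close>
    have xU: "- diag_op I x \<in> prod_set U" "- diag_op I (- x) \<in> prod_set U"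
      unfolding prod_set_def mem_Collect_eq diag_op_def vector_uminus_component vec_lambda_beta
      using x_cases I\<phi> IU by (metis minus_minus)+
    have Ax: "\<sigma> $ j *\<^sub>R A i j (x $ j) = A i j (\<phi> $ j)"
      "\<sigma> $ j *\<^sub>R A i j (- (x $ j)) = - A i j (\<phi> $ j)" for i j
      using \<sigma>[of j] linear_operator_on_neg[OF A \<phi>D[of j i]] by (auto simp: x_def)
    have Tx: "signed_matrix_op A \<sigma> x = matrix_op A \<phi>"
      "signed_matrix_op A \<sigma> (- x) = - matrix_op A \<phi>"
      by (simp_all add: signed_matrix_op_def matrix_op_def vec_eq_iff Ax sum_negf)
    have "x $ j \<in> D i j" for i j using xW W_D by (simp add: prod_set_def)
    then have TY: "signed_matrix_op A \<sigma> x \<in> prod_set Y" by (rule signed_Y)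
    \<comment> \<open>Each \<open>Z j\<close> contains 0 as a subspace, so \<Psi> must answer the
      data 0 with an element of the target space.\<close>
    have "\<Psi> 0 \<in> prod_set Y" using \<Psi> subspace_0[OF subspace_prod_set[of Z]] assms(2) by blast
    moreover have "norm_on (prod_set Y) (prod_norm \<psi> normY)"
      by (intro norm_on_prod_norm \<psi> Y_subspace Y_norm)
    moreover have "subspace (prod_set Y)" by (intro subspace_prod_set Y_subspace)
    ultimately show ?thesis
      using method_error_lower_bound[where T = "signed_matrix_op A \<sigma>" and x = x and x' = "- x"
          and I = "diag_op I" and W = "prod_set W" and U = "prod_set U" and \<Phi> = \<Psi>
          and Y = "prod_set Y" and N = "prod_norm \<psi> normY"] xW xU TY
      by (simp add: Tx)
  qed

  show ?thesis
    by (intro optimal_methodI \<Phi>_Y method_error_le upper lower)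
qed

end
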